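(* Let $M=\begin{pmatrix} a & b\\ d & \theta\end{pmatrix}$ and $M_k=\begin{pmatrix} a_k & b_k\\ d_k & \theta_k\end{pmatrix}$, $k\ge1$, be real $2\times 2$ matrices with nonnegative entries such that $\lim_{k\to\infty}M_k=M$, $a+\theta\neq0$, $b\neq0$ and $bd\neq a\theta$. Let $$\varrho=\frac{a+\theta+\sqrt{(a+\theta)^2+4(bd-a\theta)}}{2},\qquad \varrho_1=\frac{a+\theta-\sqrt{(a+\theta)^2+4(bd-a\theta)}}{2}$$ be the eigenvalues of $M$, and let $\xi_n$ be the continued fractions defined in the context. Then there exists $k_0>0$ such that for all $k\ge k_0$ and all $i,j\in\{1,2\}$, $$\frac{\mathbf e_iM_{k+1}\cdots M_{k+n}\mathbf e_j^t}{\xi_{k+1}^{-1}\cdots\xi_{k+n}^{-1}}\longrightarrow \psi(i,j,k)\quad\text{as } n\to\infty,$$ uniformly in $k\ge k_0$ (i.e. $\sup_{k\ge k_0}\big|\frac{\mathbf e_iM_{k+1}\cdots M_{k+n}\mathbf e_j^t}{\xi_{k+1}^{-1}\cdots\xi_{k+n}^{-1}}-\psi(i,j,k)\big|\to0$), where $\psi(1,1,k)=\frac{\varrho-\theta}{\varrho-\varrho_1}$, $\psi(1,2,k)=\frac{b}{\varrho-\varrho_1}$, $\psi(2,1,k)=\frac{\varrho-\theta}{\varrho-\varrho_1}\Big(\frac{\theta_{k+1}}{b_{k+1}}-\xi_{k+1}\frac{\det(M_{k+1})}{b_{k+1}}\Big)$ and $\psi(2,2,k)=\frac{b}{\varrh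o-\varrho_1}\Big(\frac{\theta_{k+1}}{b_{k+1}}-\xi_{k+1}\frac{\det(M_{k+1})}{b_{k+1}}\Big)$.
   Context: $\mathbf e_1=(1,0)$, $\mathbf e_2=(0,1)$ are row vectors and $\mathbf v^t$ denotes the transpose of $\mathbf v$. For $n\ge1$ (whenever defined, which is the case for all large $n$) set $$\beta_n=\frac{b_{n+1}}{b_n(b_{n+1}d_{n+1}-a_{n+1}\theta_{n+1})},\qquad \alpha_n=\frac{a_nb_{n+1}+b_n\theta_{n+1}}{b_n(b_{n+1}d_{n+1}-a_{n+1}\theta_{n+1})},$$ and let $\xi_n$ be the value of the continued fraction $$\xi_n=\cfrac{\beta_n}{\alpha_n+\cfrac{\beta_{n+1}}{\alpha_{n+1}+\cfrac{\beta_{n+2}}{\alpha_{n+2}+\cdots}}},$$ i.e. the limit as $m\to\infty$ of its approximants $\xi_{n,m}=\cfrac{\beta_n}{\alpha_n+\cfrac{\beta_{n+1}}{\ddots+\cfrac{\beta_m}{\alpha_m}}}$. $\det(M_{k+1})=a_{k+1}\theta_{k+1}-b_{k+1}d_{k+1}$.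
   Formalization: The formal theorem additionally assumes ϱ ≠ ϱ₁, which excludes only a = θ, d = 0; there the denominators of ψ vanish and the claim fails, e.g. M_k = M with rows (1,1), (0,1), where ξ_n = 1 and e_1 M^n e_2^t = n diverges. *)

theory Defs
  imports "HOL-Analysis.Analysis"
begin

text \<open>
  A matrix \<open>X :: real^2^2\<close> with rows \<open>(a, b)\<close> and \<open>(d, \<theta>)\<close> has
  \<open>a = X$1$1\<close>, \<open>b = X$1$2\<close>, \<open>d = X$2$1\<close>, \<open>\<theta> = X$2$2\<close>. Only the terms \<open>M k\<close> with
  \<open>k \<ge> 1\<close> of a sequence \<open>M\<close> are relevant; \<open>M 0\<close> is a dummy.
\<close>

definition rho :: "real^2^2 \<Rightarrow> real" where
  "rho A = (A$1$1 + A$2$2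
     + sqrt ((A$1$1 + A$2$2)^2 + 4 * (A$1$2 * A$2$1 - A$1$1 * A$2$2))) / 2"

definition rho1 :: "real^2^2 \<Rightarrow> real" where
  "rho1 A = (A$1$1 + A$2$2
     - sqrt ((A$1$1 + A$2$2)^2 + 4 * (A$1$2 * A$2$1 - A$1$1 * A$2$2))) / 2"

text \<open>\<open>mat_prod M k n\<close> is the ordered product of \<open>M (k+1), \<dots>, M (k+n)\<close>.\<close>

primrec mat_prod :: "(nat \<Rightarrow> real^2^2) \<Rightarrow> nat \<Rightarrow> nat \<Rightarrow> real^2^2" where
  "mat_prod M k 0 = mat 1"
| "mat_prod M k (Suc n) = mat_prod M k n ** M (k + Suc n)"

definition cf_beta :: "(nat \<Rightarrow> real^2^2) \<Rightarrow> nat \<Rightarrow> real" where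
  "cf_beta M n = M (n+1)$1$2 /
     (M n$1$2 * (M (n+1)$1$2 * M (n+1)$2$1 - M (n+1)$1$1 * M (n+1)$2$2))"

definition cf_alpha :: "(nat \<Rightarrow> real^2^2) \<Rightarrow> nat \<Rightarrow> real" where
  "cf_alpha M n = (M n$1$1 * M (n+1)$1$2 + M n$1$2 * M (n+1)$2$2) /
     (M n$1$2 * (M (n+1)$1$2 * M (n+1)$2$1 - M (n+1)$1$1 * M (n+1)$2$2))"

text \<open>
  The approximant of the continued fraction with partial numerators \<open>\<beta>\<close> and partial
  denominators \<open>\<alpha>\<close> that starts at index \<open>n\<close> and stops at index \<open>m\<close>; meaningful for \<open>n \<le> m\<close>.
\<close>

function cf_approx :: "(nat \<Rightarrow> real) \<Rightarrow> (nat \<Rightarrow> real) \<Rightarrow> nat \<Rightarrow> nat \<Rightarrow> real" where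
  "cf_approx \<beta> \<alpha> n m =
     (if n < m then \<beta> n / (\<alpha> n + cf_approx \<beta> \<alpha> (Suc n) m) else \<beta> n / \<alpha> n)"
  by pat_completeness auto
termination by (relation "Wellfounded.measure (\<lambda>(\<beta>, \<alpha>, n, m). m - n)") auto

declare cf_approx.simps [simp del]

definition xi :: "(nat \<Rightarrow> real^2^2) \<Rightarrow> nat \<Rightarrow> real" where
  "xi M n = lim (\<lambda>m. cf_approx (cf_beta M) (cf_alpha M) n m)"

text \<open>
  \<open>xi M n\<close> is a genuine continued fraction value: no division by zero occurs in the
  coefficients or in any approximant, and the approximants converge. This excludes the
  totalised values of \<open>/\<close> and \<open>lim\<close>.
\<close>

definition xi_defined :: "(nat \<Rightarrow> real^2^2) \<Rightarrow> nat \<Rightarrow> bool" where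
  "xi_defined M n \<longleftrightarrow>
     (\<forall>i\<ge>n. M i$1$2 \<noteq> 0 \<and> M (i+1)$1$2 * M (i+1)$2$1 - M (i+1)$1$1 * M (i+1)$2$2 \<noteq> 0) \<and>
     (\<forall>i\<ge>n. cf_alpha M i \<noteq> 0) \<and>
     (\<forall>i\<ge>n. \<forall>m>i. cf_alpha M i + cf_approx (cf_beta M) (cf_alpha M) (Suc i) m \<noteq> 0) \<and>
     convergent (\<lambda>m. cf_approx (cf_beta M) (cf_alpha M) n m)"

text \<open>The type \<open>2\<close> has exactly the elements \<open>1\<close> and \<open>2\<close>, so the last case is \<open>i = j = 2\<close>.\<close>

definition psi :: "real^2^2 \<Rightarrow> (nat \<Rightarrow> real^2^2) \<Rightarrow> 2 \<Rightarrow> 2 \<Rightarrow> nat \<Rightarrow> real" where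
  "psi A M i j k =
    (if i = 1 \<and> j = 1 then (rho A - A$2$2) / (rho A - rho1 A)
     else if i = 1 \<and> j = 2 then A$1$2 / (rho A - rho1 A)
     else if i = 2 \<and> j = 1 then
       (rho A - A$2$2) / (rho A - rho1 A) *
       (M (k+1)$2$2 / M (k+1)$1$2 - xi M (k+1) * (det (M (k+1)) / M (k+1)$1$2))
     else
       A$1$2 / (rho A - rho1 A) *
       (M (k+1)$2$2 / M (k+1)$1$2 - xi M (k+1) * (det (M (k+1)) / M (k+1)$1$2)))"

end

theory Submission
  imports Defs
begin

text \<open>
  Let \<open>h\<^sub>n\<close> be the slope of the direction \<open>(1, h\<^sub>n)\<close> to which the columns of
  \<open>M\<^sub>n M\<^sub>n\<^sub>+\<^sub>1 \<dots> M\<^sub>m\<close> converge as \<open>m \<rightarrow> \<infinity>\<close>. Then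
  \<open>M\<^sub>n (1, h\<^sub>n\<^sub>+\<^sub>1)\<^sup>t = \<xi>\<^sub>n\<^sup>-\<^sup>1 (1, h\<^sub>n)\<^sup>t\<close>, since the approximants of \<open>\<xi>\<^sub>n\<close> are exactly those obtained
  from the second columns of the finite products. Hence the normalised product \<open>W\<close> of
  \<open>M\<^sub>k\<^sub>+\<^sub>1, \<dots>, M\<^sub>k\<^sub>+\<^sub>n\<close> satisfies \<open>W (1, h\<^sub>k\<^sub>+\<^sub>n\<^sub>+\<^sub>1)\<^sup>t = (1, h\<^sub>k\<^sub>+\<^sub>1)\<^sup>t\<close>. Together with the limits of
  \<open>h\<^sub>n\<close>, of the ratio \<open>W\<^sub>1\<^sub>1 / W\<^sub>1\<^sub>2\<close> and of the ratio \<open>W\<^sub>2\<^sub>2 / W\<^sub>1\<^sub>2\<close> this determines the limit of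
  every entry.

  The ratios evolve under Moebius maps that converge to the map induced by the limit matrix. In the
  coordinate \<open>x = 1 / (h + p)\<close>, with \<open>- p\<close> the repelling fixed point of the limit map, that map is
  affine with slope \<open>\<rho>\<^sub>1 / \<rho>\<close>, so the maps are eventually uniform contractions of a fixed ball.
\<close>

subsection \<open>Sequences of contractions of a ball\<close>

text \<open>\<open>e / (1 - q)\<close> is the fixed point of \<open>v -> q * v + e\<close>; any
  excess over it shrinks by the factor \<open>q\<close> per step.\<close>

lemma affine_recursion_bound:
  fixes v :: "nat \<Rightarrow> real"
  assumes "\<And>i. v (Suc i) \<le> q * v i + e" "0 \<le> q" "q < 1" "0 \<le> e"
  shows "v i \<le> q ^ i * v 0 + e / (1 - q)"
proof (induction i)
  case 0
  then show ?case using assms by simp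
next
  case (Suc i)
  have "v (Suc i) \<le> q * (q ^ i * v 0 + e / (1 - q)) + e"
    using assms(1)[of i] mult_left_mono[OF Suc assms(2)] by linarith
  also have "\<dots> = q ^ Suc i * v 0 + e / (1 - q)"
    using assms(3) by (simp add: field_simps)
  finally show ?case .
qed

text \<open>The centre is fixed only in the limit. Invariance of the ball is not built in; each
  limit lemma asks its own orbits to stay inside.\<close>

locale ball_contractions =
  fixes G :: "nat \<Rightarrow> real \<Rightarrow> real" and s R q :: real and N :: nat
  assumes contraction:
      "\<And>n x y. N \<le> n \<Longrightarrow> \<bar>x - s\<bar> \<le> R \<Longrightarrow> \<bar>y - s\<bar> \<le> R \<Longrightarrow> \<bar>G n x - G n y\<bar> \<le> q * \<bar>x - y\<bar>"
    and centre_lim: "(\<lambda>n. G n s) \<longlonglongrightarrow> s"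
    and q: "0 \<le> q" "q < 1"
    and R: "0 \<le> R"
begin

lemma centre_step:
  assumes "N \<le> n" "\<bar>x - s\<bar> \<le> R" "\<bar>G n s - s\<bar> \<le> e"
  shows "\<bar>G n x - s\<bar> \<le> q * \<bar>x - s\<bar> + e"
  using contraction[of n x s] assms R by simp

lemma centre_defect_eventually:
  assumes "0 < e"
  obtains K where "N \<le> K" "\<And>n. K \<le> n \<Longrightarrow> \<bar>G n s - s\<bar> \<le> e"
proof -
  obtain K where "\<And>n. K \<le> n \<Longrightarrow> norm (G n s - s) < e"
    using LIMSEQ_D[OF centre_lim assms] by blast
  then show thesis by (intro that[of "max N K"]) (auto intro: less_imp_le)
qed

text \<open>New maps act last, so early errors are damped geometrically and only the small defects
  of late maps survive.\<close>

lemma forward_uniform_limit: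
  assumes ball: "\<And>k j. N \<le> k \<Longrightarrow> \<bar>w k j - s\<bar> \<le> R"
    and rec: "\<And>k j. N \<le> k \<Longrightarrow> w k (Suc j) = G (k + Suc j) (w k j)"
  shows "uniform_limit {N..} (\<lambda>j k. w k j) (\<lambda>_. s) sequentially"
proof (rule uniform_limitI)
  fix e :: real assume e: "0 < e"
  define e' where "e' = e * (1 - q) / 2"
  have e': "0 < e'" using e q by (simp add: e'_def)
  obtain K where K: "N \<le> K" "\<And>n. K \<le> n \<Longrightarrow> \<bar>G n s - s\<bar> \<le> e'"
    using centre_defect_eventually[OF e'] by blast
  have "(\<lambda>i. q ^ i * R) \<longlonglongrightarrow> 0 * R"
    using q by (intro tendsto_intros LIMSEQ_power_zero) auto
  then have "\<forall>\<^sub>F i in sequentially. q ^ i * R < e / 2"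
    using e by (intro order_tendstoD(2)) auto
  then obtain I where I: "\<And>i. I \<le> i \<Longrightarrow> q ^ i * R < e / 2"
    by (auto simp: eventually_sequentially)
  have "\<bar>w k j - s\<bar> < e" if "K + I \<le> j" "N \<le> k" for j k
  proof -
    obtain i where j: "j = K + i" "I \<le> i" using \<open>K + I \<le> j\<close> by (metis add.assoc le_Suc_ex le_add1)
    \<comment> \<open>Restarting at time \<open>K\<close> gives every later map an index of at least
      \<open>K\<close>, whatever \<open>k\<close> is; hence the uniformity.\<close>
    have "\<bar>w k (K + i) - s\<bar> \<le> q ^ i * \<bar>w k (K + 0) - s\<bar> + e' / (1 - q)"
    proof (rule affine_recursion_bound)
      fix i
      show "\<bar>w k (K + Suc i) - s\<bar> \<le> q * \<bar>w k (K + i) - s\<bar> + e'"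
        using centre_step[of "k + Suc (K + i)" "w k (K + i)" e'] ball[of k "K + i"] rec[of k "K + i"] K that
        by simp
    qed (use q e' in auto)
    also have "e' / (1 - q) = e / 2" using q by (simp add: e'_def field_simps)
    also have "q ^ i * \<bar>w k (K + 0) - s\<bar> + e / 2 \<le> q ^ i * R + e / 2"
      using ball[of k K] that q by (intro add_mono mult_left_mono) auto
    also have "\<dots> < e" using I[OF j(2)] by simp
    finally show ?thesis using j by simp
  qed
  then show "\<forall>\<^sub>F j in sequentially. \<forall>k\<in>{N..}. dist (w k j) s < e"
    unfolding eventually_sequentially dist_real_def by (intro exI[of _ "K + I"]) auto
qed

text \<open>New maps act first: iterates of depth at least \<open>j\<close> share their
  \<open>j\<close> outer maps, so they differ by at most \<open>q ^ j * (2 * R)\<close> for every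
  \<open>n\<close>. The limit depends on \<open>n\<close> but tends to \<open>s\<close>, since only
  maps of index at least \<open>n\<close> enter.\<close>

lemma backward_uniform_limit:
  assumes ball: "\<And>n j. N \<le> n \<Longrightarrow> \<bar>u n j - s\<bar> \<le> R"
    and rec: "\<And>n j. N \<le> n \<Longrightarrow> u n (Suc j) = G n (u (Suc n) j)"
  shows "\<exists>x. uniform_limit {N..} (\<lambda>j n. u n j) x sequentially \<and> x \<longlonglongrightarrow> s"
proof -
  have diff: "\<bar>u n j - u n (j + i)\<bar> \<le> q ^ j * (2 * R)" if "N \<le> n" for n j i
    using that
  proof (induction j arbitrary: n)
    case 0
    then show ?case using ball[of n 0] ball[of n i] by simp
  next
    case (Suc j)
    have "\<bar>u n (Suc j) - u n (Suc j + i)\<bar> \<le> q * \<bar>u (Suc n) j - u (Suc n) (j + i)\<bar>"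
      using contraction[of n "u (Suc n) j" "u (Suc n) (j + i)"] ball[of "Suc n"] rec Suc.prems by simp
    also have "\<dots> \<le> q * (q ^ j * (2 * R))"
      using Suc q by (intro mult_left_mono) auto
    finally show ?case by simp
  qed
  have "uniformly_convergent_on {N..} (\<lambda>j n. u n j)"
  proof (intro Cauchy_uniformly_convergent uniformly_Cauchy_onI')
    fix e :: real assume "0 < e"
    have "(\<lambda>i. q ^ i * (2 * R)) \<longlonglongrightarrow> 0 * (2 * R)"
      using q by (intro tendsto_intros LIMSEQ_power_zero) auto
    then have "\<forall>\<^sub>F i in sequentially. q ^ i * (2 * R) < e"
      using \<open>0 < e\<close> by (intro order_tendstoD(2)) auto
    then obtain I where I: "\<And>i. I \<le> i \<Longrightarrow> q ^ i * (2 * R) < e"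
      by (auto simp: eventually_sequentially)
    show "\<exists>I. \<forall>n\<in>{N..}. \<forall>j\<ge>I. \<forall>j'>j. dist (u n j) (u n j') < e"
    proof (intro exI[of _ I] ballI allI impI)
      fix n j j' assume "n \<in> {N..}" "I \<le> j" "j < j'"
      then show "dist (u n j) (u n j') < e"
        using diff[of n j "j' - j"] I[of j] by (simp add: dist_real_def)
    qed
  qed
  then obtain x where x: "uniform_limit {N..} (\<lambda>j n. u n j) x sequentially"
    by (auto simp: uniformly_convergent_on_def)
  have "x \<longlonglongrightarrow> s"
  proof (rule LIMSEQ_I)
    fix e :: real assume e: "0 < e"
    define e' where "e' = e * (1 - q) / 2"
    have e': "0 < e'" using e q by (simp add: e'_def)
    obtain K where K: "N \<le> K" "\<And>n. K \<le> n \<Longrightarrow> \<bar>G n s - s\<bar> \<le> e'"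
      using centre_defect_eventually[OF e'] by blast
    have "\<bar>x n - s\<bar> < e" if "K \<le> n" for n
    proof -
      have bound: "\<bar>u n j - s\<bar> \<le> q ^ j * R + e / 2" for j
        using that
      proof (induction j arbitrary: n)
        case 0
        then show ?case using ball[of n 0] K e by simp
      next
        case (Suc j)
        have "\<bar>u n (Suc j) - s\<bar> \<le> q * \<bar>u (Suc n) j - s\<bar> + e'"
          using centre_step[of n "u (Suc n) j" e'] ball[of "Suc n" j] rec[of n j] K Suc.prems by simp
        also have "\<dots> \<le> q * (q ^ j * R + e / 2) + e'"
          using Suc q by (intro add_mono mult_left_mono) auto
        also have "\<dots> = q ^ Suc j * R + e / 2" by (simp add: e'_def field_simps)
        finally show ?case .
      qed
      have "(\<lambda>j. \<bar>u n j - s\<bar>) \<longlonglongrightarrow> \<bar>x n - s\<bar>"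
        using tendsto_uniform_limitI[OF x, of n] K that by (intro tendsto_intros) auto
      moreover have "(\<lambda>j. q ^ j * R + e / 2) \<longlonglongrightarrow> 0 * R + e / 2"
        using q by (intro tendsto_intros LIMSEQ_power_zero) auto
      ultimately have "\<bar>x n - s\<bar> \<le> 0 * R + e / 2"
        by (rule LIMSEQ_le) (use bound in auto)
      then show ?thesis using e by simp
    qed
    then show "\<exists>K. \<forall>n\<ge>K. norm (x n - s) < e" by auto
  qed
  with x show ?thesis by blast
qed

end

subsection \<open>Converging Moebius maps\<close>

primrec forward_iterate :: "(nat \<Rightarrow> 'a \<Rightarrow> 'a) \<Rightarrow> (nat \<Rightarrow> 'a) \<Rightarrow> nat \<Rightarrow> nat \<Rightarrow> 'a" where
  "forward_iterate F x k 0 = x k"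
| "forward_iterate F x k (Suc j) = F (k + Suc j) (forward_iterate F x k j)"

primrec backward_iterate :: "(nat \<Rightarrow> 'a \<Rightarrow> 'a) \<Rightarrow> (nat \<Rightarrow> 'a) \<Rightarrow> nat \<Rightarrow> nat \<Rightarrow> 'a" where
  "backward_iterate F x n 0 = x n"
| "backward_iterate F x n (Suc j) = F n (backward_iterate F x (Suc n) j)"

text \<open>Action on slopes: the matrix with rows \<open>(a n, b n)\<close> and
  \<open>(d n, t n)\<close> sends the direction of \<open>(1, h)\<close> to that of
  \<open>(1, h')\<close> with \<open>h'\<close> the value below.\<close>

definition moebius_map ::
    "(nat \<Rightarrow> real) \<Rightarrow> (nat \<Rightarrow> real) \<Rightarrow> (nat \<Rightarrow> real) \<Rightarrow> (nat \<Rightarrow> real) \<Rightarrow> nat \<Rightarrow> real \<Rightarrow> real" where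
  "moebius_map a b d t n h = (d n + t n * h) / (a n + b n * h)"

text \<open>The eigenvalues enter only through sum and product, so the locale also applies with
  \<open>a\<close> and \<open>t\<close> exchanged, which gives the action on rows instead of
  columns.\<close>

locale moebius_limit =
  fixes a b d t :: "nat \<Rightarrow> real" and a' b' d' t' r r1 :: real
  assumes a_lim: "a \<longlonglongrightarrow> a'" and b_lim: "b \<longlonglongrightarrow> b'" and d_lim: "d \<longlonglongrightarrow> d'" and t_lim: "t \<longlonglongrightarrow> t'"
    and b_pos: "0 < b'" and dominant: "\<bar>r1\<bar> < r"
    and sum_eigenvalues: "r + r1 = a' + t'" and prod_eigenvalues: "r * r1 = a' * t' - b' * d'"
begin

abbreviation F :: "nat \<Rightarrow> real \<Rightarrow> real" where
  "F \<equiv> moebius_map a b d t"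

abbreviation start :: "nat \<Rightarrow> real" where
  "start \<equiv> \<lambda>n. t n / b n"

text \<open>
  \<open>G\<close> is \<open>F\<close> in the coordinate \<open>x = 1 / (h + p)\<close>, and \<open>s\<close> is the fixed point of its limit
  \<open>x \<mapsto> (b' + r1 x) / r\<close>.
\<close>

definition p :: real where "p = (r - t') / b'"
definition s :: real where "s = b' / (r - r1)"

text \<open>With \<open>y = h + p\<close> the map \<open>F n\<close> becomes
  \<open>y -> (E n + T n * y) / (A n + b n * y)\<close>; then \<open>x = 1 / y\<close> yields
  \<open>G n\<close>.\<close>

definition A :: "nat \<Rightarrow> real" where "A n = a n - p * b n"
definition T :: "nat \<Rightarrow> real" where "T n = t n + p * b n"
definition E :: "nat \<Rightarrow> real" where "E n = d n + p * a n - p * t n - p\<^sup>2 * b n"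

definition G :: "nat \<Rightarrow> real \<Rightarrow> real" where
  "G n x = (b n + A n * x) / (T n + E n * x)"

section \<open>Limits of the coefficients of \<open>G\<close>\<close>

lemma r_pos: "0 < r" and r_diff: "r1 < r"
  using dominant by auto

lemma s_pos: "0 < s"
  using b_pos r_diff by (simp add: s_def)

lemma A_lim: "A \<longlonglongrightarrow> r1"
proof -
  have "A \<longlonglongrightarrow> a' - p * b'"
    unfolding A_def by (intro tendsto_intros a_lim b_lim)
  moreover have "a' - p * b' = r1"
    using b_pos sum_eigenvalues by (simp add: p_def)
  ultimately show ?thesis by simp
qed

lemma T_lim: "T \<longlonglongrightarrow> r"
proof -
  have "T \<longlonglongrightarrow> t' + p * b'"
    unfolding T_def by (intro tendsto_intros t_lim b_lim)
  moreover have "t' + p * b' = r"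
    using b_pos by (simp add: p_def)
  ultimately show ?thesis by simp
qed

text \<open>The limit vanishes because \<open>- p\<close> is fixed by the limit map; multiplied by
  \<open>b'\<close>, this is the characteristic equation at \<open>r\<close>.\<close>

lemma E_lim: "E \<longlonglongrightarrow> 0"
proof -
  have "E \<longlonglongrightarrow> d' + p * a' - p * t' - p\<^sup>2 * b'"
    unfolding E_def by (intro tendsto_intros d_lim a_lim t_lim b_lim)
  moreover have "d' + p * a' - p * t' - p\<^sup>2 * b' = 0"
  proof -
    have pb: "p * b' = r - t'" using b_pos by (simp add: p_def)
    have a': "a' = r + r1 - t'" using sum_eigenvalues by simp
    have "b' * (d' + p * a' - p * t' - p\<^sup>2 * b') =
        b' * d' + (p * b') * a' - (p * b') * t' - (p * b')\<^sup>2"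
      by (simp add: algebra_simps power2_eq_square)
    also have "\<dots> = b' * d' - a' * t' + r * r1"
      unfolding pb a' by (simp add: algebra_simps power2_eq_square)
    finally show ?thesis using prod_eigenvalues b_pos by simp
  qed
  ultimately show ?thesis by simp
qed

lemma G_centre_lim: "(\<lambda>n. G n s) \<longlonglongrightarrow> s"
proof -
  have "(\<lambda>n. G n s) \<longlonglongrightarrow> (b' + r1 * s) / (r + 0 * s)"
    unfolding G_def using r_pos by (intro tendsto_intros b_lim A_lim T_lim E_lim) auto
  moreover have "(b' + r1 * s) / (r + 0 * s) = s"
    using r_pos r_diff by (simp add: s_def field_simps)
  ultimately show ?thesis by simp
qed

lemma G_diff:
  assumes "T n + E n * x \<noteq> 0" "T n + E n * y \<noteq> 0"
  shows "G n x - G n y = (A n * T n - b n * E n) * (x - y) / ((T n + E n * x) * (T n + E n * y))"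
  using assms unfolding G_def by (simp add: diff_frac_eq) (simp add: algebra_simps)

text \<open>The ball must also contain \<open>b n / T n\<close>, which is \<open>start n\<close> in
  the coordinate \<open>x\<close>.\<close>

lemma eventually_contracting:
  obtains R q N where "ball_contractions G s R q N" "R < s"
    "\<forall>n\<ge>N. 0 < b n \<and> 0 < T n \<and> \<bar>b n / T n - s\<bar> \<le> R"
    "\<forall>n\<ge>N. \<forall>x. \<bar>x - s\<bar> \<le> R \<longrightarrow> 0 < T n + E n * x \<and> \<bar>G n x - s\<bar> \<le> R"
proof -
  \<comment> \<open>The midpoint between the limiting slope \<open>|r1| / r\<close> and
    \<open>1\<close>.\<close>
  define q where "q = (\<bar>r1\<bar> / r + 1) / 2"
  have q: "\<bar>r1\<bar> / r < q" "0 < q" "q < 1"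
    using dominant r_pos by (auto simp: q_def field_simps)
  \<comment> \<open>The radius must exceed \<open>\<bar>r1\<bar> / r * s\<close>, the distance of the limiting start \<open>b' / r\<close> from \<open>s\<close>,
    and stay below \<open>s\<close> so that \<open>h = 1 / x - p\<close> remains finite.\<close>
  define R where "R = q * s"
  have R: "0 < R" "R < s" using q s_pos by (auto simp: R_def)
  \<comment> \<open>\<open>L n\<close> bounds the denominator of \<open>G n x\<close> from below on
    the ball, where \<open>|x| \<le> 2 * s\<close>.\<close>
  define L where "L = (\<lambda>n. T n - 2 * s * \<bar>E n\<bar>)"
  have "L \<longlonglongrightarrow> r - 2 * s * \<bar>0\<bar>"
    unfolding L_def by (intro tendsto_intros T_lim E_lim)
  then have L_lim: "L \<longlonglongrightarrow> r" by simp
  have "(\<lambda>n. \<bar>A n * T n - b n * E n\<bar> / (L n)\<^sup>2) \<longlonglongrightarrow> \<bar>r1 * r - b' * 0\<bar> / r\<^sup>2"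
    using r_pos by (intro tendsto_intros A_lim T_lim b_lim E_lim L_lim) auto
  moreover have "\<bar>r1 * r - b' * 0\<bar> / r\<^sup>2 = \<bar>r1\<bar> / r"
    using r_pos by (simp add: abs_mult power2_eq_square)
  ultimately have ev_q: "\<forall>\<^sub>F n in sequentially. \<bar>A n * T n - b n * E n\<bar> / (L n)\<^sup>2 < q"
    using q by (intro order_tendstoD(2)) auto
  have ev_L: "\<forall>\<^sub>F n in sequentially. 0 < L n"
    using r_pos by (intro order_tendstoD(1)[OF L_lim])
  have "(\<lambda>n. \<bar>G n s - s\<bar>) \<longlonglongrightarrow> \<bar>s - s\<bar>"
    by (intro tendsto_intros G_centre_lim)
  \<comment> \<open>A defect below \<open>(1 - q) * R\<close> plus the contracted radius
    \<open>q * R\<close> stays below \<open>R\<close>, so the ball is mapped into itself.\<close>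
  then have ev_G: "\<forall>\<^sub>F n in sequentially. \<bar>G n s - s\<bar> < (1 - q) * R"
    using q R by (intro order_tendstoD(2)) auto
  have ev_b: "\<forall>\<^sub>F n in sequentially. 0 < b n"
    by (intro order_tendstoD(1)[OF b_lim] b_pos)
  have ev_T: "\<forall>\<^sub>F n in sequentially. 0 < T n"
    by (intro order_tendstoD(1)[OF T_lim] r_pos)
  have start_dist: "\<bar>b' / r - s\<bar> < R"
  proof -
    have "b' / r - s = - (r1 / r) * s"
      using r_pos r_diff by (simp add: s_def field_simps)
    then have "\<bar>b' / r - s\<bar> = \<bar>r1\<bar> / r * s"
      using s_pos r_pos by (simp add: abs_mult)
    then show ?thesis
      using mult_strict_right_mono[OF q(1) s_pos] by (simp add: R_def)
  qed
  have "(\<lambda>n. \<bar>b n / T n - s\<bar>) \<longlonglongrightarrow> \<bar>b' / r - s\<bar>"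
    using r_pos by (intro tendsto_intros b_lim T_lim) auto
  then have ev_start: "\<forall>\<^sub>F n in sequentially. \<bar>b n / T n - s\<bar> < R"
    using start_dist by (rule order_tendstoD(2))
  from ev_q ev_L ev_G ev_b ev_T ev_start
  have "\<forall>\<^sub>F n in sequentially. \<bar>A n * T n - b n * E n\<bar> / (L n)\<^sup>2 < q \<and> 0 < L n \<and>
      \<bar>G n s - s\<bar> < (1 - q) * R \<and> 0 < b n \<and> 0 < T n \<and> \<bar>b n / T n - s\<bar> < R"
    by eventually_elim auto
  then obtain N where N: "\<And>n. N \<le> n \<Longrightarrow> \<bar>A n * T n - b n * E n\<bar> / (L n)\<^sup>2 < q \<and> 0 < L n \<and>
      \<bar>G n s - s\<bar> < (1 - q) * R \<and> 0 < b n \<and> 0 < T n \<and> \<bar>b n / T n - s\<bar> < R"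
    by (auto simp: eventually_sequentially)
  have denom: "L n \<le> T n + E n * x" if "\<bar>x - s\<bar> \<le> R" for n x
  proof -
    have "\<bar>x\<bar> \<le> 2 * s" using that R by linarith
    then have "\<bar>E n * x\<bar> \<le> \<bar>E n\<bar> * (2 * s)"
      unfolding abs_mult by (intro mult_left_mono) auto
    then show ?thesis unfolding L_def by (simp add: mult.commute abs_le_iff)
  qed
  have contr: "\<bar>G n x - G n y\<bar> \<le> q * \<bar>x - y\<bar>"
    if n: "N \<le> n" and x: "\<bar>x - s\<bar> \<le> R" and y: "\<bar>y - s\<bar> \<le> R" for n x y
  proof -
    let ?D = "\<bar>A n * T n - b n * E n\<bar>"
    have Lp: "0 < L n" and Lq: "?D / (L n)\<^sup>2 < q" using N[OF n] by auto
    note dx = denom[OF x, of n] and dy = denom[OF y, of n]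
    have pos: "0 < T n + E n * x" "0 < T n + E n * y" using Lp dx dy by auto
    have LL: "(L n)\<^sup>2 \<le> (T n + E n * x) * (T n + E n * y)"
      unfolding power2_eq_square using Lp dx dy by (intro mult_mono) auto
    have "\<bar>G n x - G n y\<bar> = ?D * \<bar>x - y\<bar> / ((T n + E n * x) * (T n + E n * y))"
      using pos by (subst G_diff) (auto simp: abs_mult)
    also have "\<dots> \<le> ?D * \<bar>x - y\<bar> / (L n)\<^sup>2"
      using Lp LL by (intro divide_left_mono mult_pos_pos pos) auto
    also have "\<dots> = ?D / (L n)\<^sup>2 * \<bar>x - y\<bar>" by simp
    also have "\<dots> \<le> q * \<bar>x - y\<bar>"
      using Lq by (intro mult_right_mono) auto
    finally show ?thesis .
  qed
  have maps: "0 < T n + E n * x \<and> \<bar>G n x - s\<bar> \<le> R"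
    if n: "N \<le> n" and x: "\<bar>x - s\<bar> \<le> R" for n x
  proof -
    have "\<bar>G n x - G n s\<bar> \<le> q * \<bar>x - s\<bar>" using contr[OF n x, of s] R by simp
    also have "\<dots> \<le> q * R" using x q by (intro mult_left_mono) auto
    finally have "\<bar>G n x - s\<bar> \<le> R" using N[OF n] by (simp add: algebra_simps) linarith
    then show ?thesis using denom[OF x, of n] N[OF n] by auto
  qed
  have "ball_contractions G s R q N"
    by unfold_locales (use contr G_centre_lim q R in auto)
  then show thesis
    by (rule that) (use R N maps in \<open>auto intro: less_imp_le\<close>)
qed

text \<open>The positivity conditions keep the coordinate change and the denominator of
  \<open>F\<close> away from division by zero.\<close>

lemma F_conjugate:
  assumes "0 < x" "0 < T n + E n * x" "0 < G n x"
  shows "0 < a n + b n * (inverse x - p)" "F n (inverse x - p) = inverse (G n x) - p"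
proof -
  have num: "a n + b n * (inverse x - p) = G n x * (T n + E n * x) / x"
  proof -
    have "G n x * (T n + E n * x) = b n + A n * x"
      using assms(2) by (simp add: G_def)
    then show ?thesis using assms(1) by (simp add: A_def field_simps)
  qed
  then show pos: "0 < a n + b n * (inverse x - p)" using assms by simp
  have "(d n + t n * (inverse x - p)) + p * (a n + b n * (inverse x - p)) = (T n + E n * x) / x"
    using assms by (simp add: E_def T_def field_simps power2_eq_square)
  then have "F n (inverse x - p) + p = ((T n + E n * x) / x) / (a n + b n * (inverse x - p))"
    using pos unfolding moebius_map_def by (simp add: field_simps)
  also have "\<dots> = inverse (G n x)"
    using assms unfolding num by (simp add: inverse_eq_divide)
  finally show "F n (inverse x - p) = inverse (G n x) - p" by simp
qed

text \<open>This slope belongs to the eigenvector of the limit matrix for \<open>r\<close>.\<close>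

lemma fixed_point: "inverse s - p = (r - a') / b'"
proof -
  have "inverse s - p = (t' - r1) / b'"
    by (simp add: s_def p_def diff_divide_distrib)
  also have "t' - r1 = r - a'" using sum_eigenvalues by simp
  finally show ?thesis .
qed

text \<open>Both ball limits are carried over by \<open>h = 1 / x - p\<close>. The ball keeps
  distance \<open>s - R > 0\<close> from \<open>0\<close>, so inversion preserves uniform
  convergence.\<close>

lemma iterates:
  obtains N h where
    "\<forall>n\<ge>N. 0 < b n"
    "\<forall>n\<ge>N. \<forall>j. 0 < a n + b n * backward_iterate F start (Suc n) j"
    "uniform_limit {N..} (\<lambda>j n. backward_iterate F start n j) h sequentially"
    "\<forall>n\<ge>N. 0 < a n + b n * h (Suc n)"
    "h \<longlonglongrightarrow> (r - a') / b'"
    "\<forall>k\<ge>N. \<forall>j. 0 < a (k + Suc j) + b (k + Suc j) * forward_iterate F start k j"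
    "uniform_limit {N..} (\<lambda>j k. forward_iterate F start k j) (\<lambda>_. (r - a') / b') sequentially"
proof -
  obtain R q N where contr: "ball_contractions G s R q N" and "R < s"
    and init: "\<forall>n\<ge>N. 0 < b n \<and> 0 < T n \<and> \<bar>b n / T n - s\<bar> \<le> R"
    and maps: "\<forall>n\<ge>N. \<forall>x. \<bar>x - s\<bar> \<le> R \<longrightarrow> 0 < T n + E n * x \<and> \<bar>G n x - s\<bar> \<le> R"
    using eventually_contracting .
  interpret ball_contractions G s R q N by (rule contr)
  let ?x0 = "\<lambda>n. b n / T n"
  let ?u = "backward_iterate G ?x0" and ?w = "forward_iterate G ?x0"
  have u_ball: "\<bar>?u n j - s\<bar> \<le> R" if "N \<le> n" for n j
    using that
  proof (induction j arbitrary: n)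
    case (Suc j)
    then show ?case using maps[rule_format, of n "?u (Suc n) j"] by simp
  qed (use init in simp)
  have w_ball: "\<bar>?w k j - s\<bar> \<le> R" if "N \<le> k" for k j
    using that
  proof (induction j)
    case (Suc j)
    then show ?case using maps[rule_format, of "k + Suc j" "?w k j"] by simp
  qed (use init in simp)
  have ball_pos: "s - R \<le> x" "0 < x" if "\<bar>x - s\<bar> \<le> R" for x
    using that \<open>R < s\<close> by auto
  have conj: "0 < a n + b n * (inverse x - p)" "F n (inverse x - p) = inverse (G n x) - p"
    if "N \<le> n" "\<bar>x - s\<bar> \<le> R" for n x
    using F_conjugate[of x n] maps[rule_format, OF that] ball_pos that by auto
  have init_eq: "start n = inverse (?x0 n) - p" if "N \<le> n" for n
    using init[rule_format, OF that] by (simp add: T_def field_simps)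
  have back_eq: "backward_iterate F start n j = inverse (?u n j) - p" if "N \<le> n" for n j
    using that
  proof (induction j arbitrary: n)
    case (Suc j)
    then show ?case using conj(2)[of n "?u (Suc n) j"] u_ball[of "Suc n" j] by simp
  qed (use init_eq in simp)
  have forw_eq: "forward_iterate F start k j = inverse (?w k j) - p" if "N \<le> k" for k j
    using that
  proof (induction j)
    case (Suc j)
    then show ?case using conj(2)[of "k + Suc j" "?w k j"] w_ball[of k j] by simp
  qed (use init_eq in simp)
  obtain x where x: "uniform_limit {N..} (\<lambda>j n. ?u n j) x sequentially" "x \<longlonglongrightarrow> s"
    using backward_uniform_limit[of ?u] u_ball backward_iterate.simps(2) by blast
  have x_ball: "\<bar>x n - s\<bar> \<le> R" if "N \<le> n" for n
  proof (rule LIMSEQ_le_const2)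
    show "(\<lambda>j. \<bar>?u n j - s\<bar>) \<longlonglongrightarrow> \<bar>x n - s\<bar>"
      using tendsto_uniform_limitI[OF x(1), of n] that by (intro tendsto_intros) auto
  qed (use u_ball that in auto)
  have ulim: "uniform_limit {N..} (\<lambda>j n. inverse (?u n j) - p) (\<lambda>n. inverse (x n) - p) sequentially"
  proof (intro uniform_limit_intros)
    have "s - R \<le> norm (x n)" if "n \<in> {N..}" for n
      using x_ball[of n] that by auto
    then show "uniform_limit {N..} (\<lambda>j n. inverse (?u n j)) (\<lambda>n. inverse (x n)) sequentially"
      using uniform_lim_inverse[OF x(1), of "s - R"] \<open>R < s\<close> by (simp add: o_def)
  qed
  have wlim: "uniform_limit {N..} (\<lambda>j k. inverse (?w k j) - p) (\<lambda>_. inverse s - p) sequentially"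
  proof (intro uniform_limit_intros)
    have "uniform_limit {N..} (\<lambda>j k. ?w k j) (\<lambda>_. s) sequentially"
      by (rule forward_uniform_limit) (use w_ball in auto)
    then show "uniform_limit {N..} (\<lambda>j k. inverse (?w k j)) (\<lambda>_. inverse s) sequentially"
      using uniform_lim_inverse[of _ _ "\<lambda>_. s" _ s] s_pos by (simp add: o_def)
  qed
  show thesis
  proof (rule that[of N "\<lambda>n. inverse (x n) - p"])
    show "uniform_limit {N..} (\<lambda>j n. backward_iterate F start n j) (\<lambda>n. inverse (x n) - p) sequentially"
      by (rule uniform_limit_cong[THEN iffD2, OF _ _ ulim]) (auto simp: back_eq)
    show "uniform_limit {N..} (\<lambda>j k. forward_iterate F start k j) (\<lambda>_. (r - a') / b') sequentially"
      by (rule uniform_limit_cong[THEN iffD2, OF _ _ wlim]) (auto simp: forw_eq fixed_point)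
    show "(\<lambda>n. inverse (x n) - p) \<longlonglongrightarrow> (r - a') / b'"
      unfolding fixed_point[symmetric] using s_pos by (intro tendsto_intros x(2)) auto
  qed (use init conj(1) back_eq forw_eq u_ball w_ball x_ball in auto)
qed

end

subsection \<open>Products of matrices and the continued fraction\<close>

lemma matrix_mult_2_component:
  fixes X Y :: "real^2^2"
  shows "(X ** Y) $ i $ j = X$i$1 * Y$1$j + X$i$2 * Y$2$j"
  by (simp add: matrix_matrix_mult_def sum_2)

text \<open>\<open>mat_prod\<close> grows on the right, whereas column ratios evolve by factors
  added on the left.\<close>

lemma mat_prod_Suc_left: "mat_prod M k (Suc n) = M (Suc k) ** mat_prod M (Suc k) n"
proof (induction n)
  case 0
  then show ?case by simp
next
  case (Suc n)
  have "mat_prod M k (Suc (Suc n)) = (M (Suc k) ** mat_prod M (Suc k) n) ** M (k + Suc (Suc n))"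
    using Suc by simp
  then show ?case by (simp add: matrix_mul_assoc)
qed

text \<open>
  \<open>column_ratio M n j\<close> is the ratio of the lower to the upper entry in the second column of
  \<open>M n ** \<dots> ** M (n + j)\<close>; \<open>row_ratio M n j\<close> is the ratio of the left to the right entry in its
  first row.
\<close>

abbreviation column_ratio :: "(nat \<Rightarrow> real^2^2) \<Rightarrow> nat \<Rightarrow> nat \<Rightarrow> real" where
  "column_ratio M \<equiv> backward_iterate
     (moebius_map (\<lambda>n. M n$1$1) (\<lambda>n. M n$1$2) (\<lambda>n. M n$2$1) (\<lambda>n. M n$2$2))
     (\<lambda>n. M n$2$2 / M n$1$2)"

abbreviation row_ratio :: "(nat \<Rightarrow> real^2^2) \<Rightarrow> nat \<Rightarrow> nat \<Rightarrow> real" where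
  "row_ratio M \<equiv> forward_iterate
     (moebius_map (\<lambda>n. M n$2$2) (\<lambda>n. M n$1$2) (\<lambda>n. M n$2$1) (\<lambda>n. M n$1$1))
     (\<lambda>n. M n$1$1 / M n$1$2)"

text \<open>A left factor maps a column proportional to \<open>(1, z)\<close> by its Moebius action
  on \<open>z\<close>, so peeling off the leftmost matrix is one backward step.\<close>

lemma mat_prod_column_ratio:
  assumes "\<And>n. N \<le> n \<Longrightarrow> M n$1$2 \<noteq> 0"
    and "\<And>n j. N \<le> n \<Longrightarrow> M n$1$1 + M n$1$2 * column_ratio M (Suc n) j \<noteq> 0"
    and "N \<le> Suc k"
  shows "mat_prod M k (Suc n)$2$2 = column_ratio M (Suc k) n * mat_prod M k (Suc n)$1$2"
  using assms(3)
proof (induction n arbitrary: k)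
  case 0
  then show ?case using assms(1) by (simp add: matrix_mult_2_component)
next
  case (Suc n)
  define X where "X = mat_prod M (Suc k) (Suc n)"
  define Y where "Y = M (Suc k)"
  define z where "z = column_ratio M (Suc (Suc k)) n"
  have X: "X$2$2 = z * X$1$2"
    unfolding X_def z_def using Suc.prems by (intro Suc.IH) simp
  have rec: "mat_prod M k (Suc (Suc n)) = Y ** X"
    unfolding X_def Y_def by (rule mat_prod_Suc_left)
  have Y: "Y$1$1 + Y$1$2 * z \<noteq> 0"
    using assms(2)[of "Suc k" n] Suc.prems unfolding Y_def z_def by simp
  have rat: "column_ratio M (Suc k) (Suc n) = (Y$2$1 + Y$2$2 * z) / (Y$1$1 + Y$1$2 * z)"
    unfolding Y_def z_def by (simp add: moebius_map_def)
  have "(Y ** X)$1$2 = (Y$1$1 + Y$1$2 * z) * X$1$2"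
    by (simp add: matrix_mult_2_component X algebra_simps)
  moreover have "(Y ** X)$2$2 = (Y$2$1 + Y$2$2 * z) * X$1$2"
    by (simp add: matrix_mult_2_component X algebra_simps)
  ultimately show ?case unfolding rec rat using Y by simp
qed

text \<open>A right factor \<open>Y\<close> maps a row proportional to \<open>(z, 1)\<close> to one
  with ratio \<open>(Y$2$1 + Y$1$1 * z) / (Y$2$2 + Y$1$2 * z)\<close>, one forward step.\<close>

lemma mat_prod_row_ratio:
  assumes "\<And>n. N \<le> n \<Longrightarrow> 0 < M n$1$2"
    and "\<And>k j. N \<le> k \<Longrightarrow> 0 < M (k + Suc j)$2$2 + M (k + Suc j)$1$2 * row_ratio M k j"
    and "N \<le> Suc k"
  shows "0 < mat_prod M k (Suc n)$1$2 \<and>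
    mat_prod M k (Suc n)$1$1 = row_ratio M (Suc k) n * mat_prod M k (Suc n)$1$2"
proof (induction n)
  case 0
  then show ?case using assms(1)[OF assms(3)] by (simp add: matrix_mult_2_component)
next
  case (Suc n)
  define X where "X = mat_prod M k (Suc n)"
  define Y where "Y = M (Suc k + Suc n)"
  define z where "z = row_ratio M (Suc k) n"
  have X: "0 < X$1$2" "X$1$1 = z * X$1$2" using Suc unfolding X_def z_def by auto
  have Y: "0 < Y$2$2 + Y$1$2 * z" using assms(2)[of "Suc k" n] assms(3) unfolding Y_def z_def by simp
  have rec: "mat_prod M k (Suc (Suc n)) = X ** Y" unfolding X_def Y_def by simp
  have rat: "row_ratio M (Suc k) (Suc n) = (Y$2$1 + Y$1$1 * z) / (Y$2$2 + Y$1$2 * z)"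
    unfolding Y_def z_def by (simp add: moebius_map_def)
  have "(X ** Y)$1$2 = X$1$2 * (Y$2$2 + Y$1$2 * z)"
    by (simp add: matrix_mult_2_component X(2) algebra_simps)
  moreover have "(X ** Y)$1$1 = X$1$2 * (Y$2$1 + Y$1$1 * z)"
    by (simp add: matrix_mult_2_component X(2) algebra_simps)
  ultimately show ?case unfolding rec rat using X Y by simp
qed

text \<open>The assumption says that \<open>M n\<close> maps \<open>(1, h (Suc n))\<close> to a
  multiple of \<open>(1, h n)\<close>; along the product these multiples accumulate.\<close>

lemma mat_prod_invariant_direction:
  assumes "\<And>n. N \<le> n \<Longrightarrow> M n$2$1 + M n$2$2 * h (Suc n) = h n * (M n$1$1 + M n$1$2 * h (Suc n))"
    and "N \<le> Suc k"
  shows "mat_prod M k n$1$1 + mat_prod M k n$1$2 * h (Suc (k + n)) =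
      (\<Prod>l=1..n. M (k + l)$1$1 + M (k + l)$1$2 * h (Suc (k + l)))"
    "mat_prod M k n$2$1 + mat_prod M k n$2$2 * h (Suc (k + n)) =
      h (Suc k) * (\<Prod>l=1..n. M (k + l)$1$1 + M (k + l)$1$2 * h (Suc (k + l)))"
proof -
  have step: "(X ** M m)$i$1 + (X ** M m)$i$2 * h (Suc m) =
      (X$i$1 + X$i$2 * h m) * (M m$1$1 + M m$1$2 * h (Suc m))" if "N \<le> m"
    for X :: "real^2^2" and i m
  proof -
    have "(X ** M m)$i$1 + (X ** M m)$i$2 * h (Suc m) =
        X$i$1 * (M m$1$1 + M m$1$2 * h (Suc m)) + X$i$2 * (M m$2$1 + M m$2$2 * h (Suc m))"
      by (simp add: matrix_mult_2_component algebra_simps)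
    then show ?thesis unfolding assms(1)[OF that] by (simp add: algebra_simps)
  qed
  show "mat_prod M k n$1$1 + mat_prod M k n$1$2 * h (Suc (k + n)) =
      (\<Prod>l=1..n. M (k + l)$1$1 + M (k + l)$1$2 * h (Suc (k + l)))"
    by (induction n) (use step[of "k + Suc _"] assms(2) in \<open>auto simp: mat_def\<close>)
  show "mat_prod M k n$2$1 + mat_prod M k n$2$2 * h (Suc (k + n)) =
      h (Suc k) * (\<Prod>l=1..n. M (k + l)$1$1 + M (k + l)$1$2 * h (Suc (k + l)))"
    by (induction n) (use step[of "k + Suc _"] assms(2) in \<open>auto simp: mat_def\<close>)
qed

text \<open>Coefficients of index \<open>m\<close> involve \<open>M (m + 1)\<close>, so the
  approximant stopped at \<open>n + j\<close> sees the \<open>j + 1\<close> matrices after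
  \<open>M n\<close>, as does the column ratio. The second claim keeps the approximants free of
  division by zero.\<close>

lemma cf_approx_column_ratio:
  assumes b: "\<And>n. N \<le> n \<Longrightarrow> M n$1$2 \<noteq> 0"
    and det: "\<And>n. N \<le> n \<Longrightarrow> M n$1$2 * M n$2$1 - M n$1$1 * M n$2$2 \<noteq> 0"
    and denom: "\<And>n j. N \<le> n \<Longrightarrow> M n$1$1 + M n$1$2 * column_ratio M (Suc n) j \<noteq> 0"
    and n: "N \<le> n"
  shows "cf_approx (cf_beta M) (cf_alpha M) n (n + j) =
      inverse (M n$1$1 + M n$1$2 * column_ratio M (Suc n) j)"
    and "cf_alpha M n + cf_approx (cf_beta M) (cf_alpha M) (Suc n) (Suc n + j) \<noteq> 0"
proof -
  have alpha0: "cf_alpha M n = cf_beta M n * (M n$1$1 + M n$1$2 * column_ratio M (Suc n) 0)"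
    if "N \<le> n" for n
    using b[OF that] b[of "Suc n"] det[of "Suc n"] that
    by (simp add: cf_alpha_def cf_beta_def field_simps)
  \<comment> \<open>This identity turns one continued fraction step into one Moebius step;
    \<open>alpha0\<close> is its counterpart for the last denominator.\<close>
  have alpha: "cf_alpha M n + inverse (M (Suc n)$1$1 + M (Suc n)$1$2 * column_ratio M (Suc (Suc n)) j) =
      cf_beta M n * (M n$1$1 + M n$1$2 * column_ratio M (Suc n) (Suc j))" if "N \<le> n" for n j
  proof -
    define h where "h = column_ratio M (Suc (Suc n)) j"
    define b1 d1 a1 t1 b0 a0 where "b1 = M (Suc n)$1$2" and "d1 = M (Suc n)$2$1"
      and "a1 = M (Suc n)$1$1" and "t1 = M (Suc n)$2$2" and "b0 = M n$1$2" and "a0 = M n$1$1"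
    define D x where "D = b1 * d1 - a1 * t1" and "x = a1 + b1 * h"
    have nz: "b0 \<noteq> 0" "D \<noteq> 0" "x \<noteq> 0"
      using b[OF that] det[of "Suc n"] denom[of "Suc n" j] that
      by (auto simp: b0_def D_def x_def a1_def b1_def d1_def t1_def h_def)
    \<comment> \<open>Splitting off the determinant \<open>D\<close> isolates the term that becomes
      \<open>inverse x\<close>.\<close>
    have "b1 * (d1 + t1 * h) = t1 * x + D" by (simp add: D_def x_def algebra_simps)
    moreover have "b1 * (a0 + b0 * ((d1 + t1 * h) / x)) = a0 * b1 + b0 * (b1 * (d1 + t1 * h)) / x"
      using nz by (simp add: field_simps)
    ultimately have key: "b1 * (a0 + b0 * ((d1 + t1 * h) / x)) = a0 * b1 + b0 * t1 + b0 * D / x"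
      using nz by (simp add: field_simps)
    have "(a0 * b1 + b0 * t1) / (b0 * D) + inverse x = (a0 * b1 + b0 * t1 + b0 * D / x) / (b0 * D)"
      using nz by (simp add: field_simps)
    also have "\<dots> = b1 / (b0 * D) * (a0 + b0 * ((d1 + t1 * h) / x))"
      unfolding key[symmetric] by simp
    finally show ?thesis
      by (simp add: cf_alpha_def cf_beta_def moebius_map_def D_def x_def a0_def a1_def b0_def b1_def
          d1_def t1_def h_def)
  qed
  have beta: "cf_beta M n \<noteq> 0" if "N \<le> n" for n
    using b[OF that] b[of "Suc n"] det[of "Suc n"] that by (simp add: cf_beta_def)
  have approx: "cf_approx (cf_beta M) (cf_alpha M) n (n + j) =
      inverse (M n$1$1 + M n$1$2 * column_ratio M (Suc n) j)" if "N \<le> n" for n j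
    using that
  proof (induction j arbitrary: n)
    case 0
    then show ?case using alpha0[of n] beta[of n]
      by (subst cf_approx.simps) (simp add: inverse_eq_divide)
  next
    case (Suc j)
    have "cf_approx (cf_beta M) (cf_alpha M) n (n + Suc j) =
        cf_beta M n / (cf_alpha M n + cf_approx (cf_beta M) (cf_alpha M) (Suc n) (Suc n + j))"
      by (subst cf_approx.simps) simp
    also have "\<dots> = inverse (M n$1$1 + M n$1$2 * column_ratio M (Suc n) (Suc j))"
      using Suc beta[of n] by (simp only: Suc.IH[of "Suc n"] alpha le_SucI) (simp add: inverse_eq_divide)
    finally show ?case .
  qed
  show "cf_approx (cf_beta M) (cf_alpha M) n (n + j) =
      inverse (M n$1$1 + M n$1$2 * column_ratio M (Suc n) j)"
    by (rule approx[OF n])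
  show "cf_alpha M n + cf_approx (cf_beta M) (cf_alpha M) (Suc n) (Suc n + j) \<noteq> 0"
    using approx[of "Suc n" j] alpha[OF n, of j] beta[OF n] denom[OF n, of "Suc j"] n by simp
qed

subsection \<open>The limit theorem\<close>

lemma rho_sum: "rho A + rho1 A = A$1$1 + A$2$2"
  by (simp add: rho_def rho1_def field_simps)

text \<open>Nonnegative entries make the discriminant \<open>(a - t)^2 + 4 * b * d\<close>
  nonnegative, so the square of its root is the discriminant itself.\<close>

lemma rho_prod:
  assumes "\<forall>i j. 0 \<le> A$i$j"
  shows "rho A * rho1 A = A$1$1 * A$2$2 - A$1$2 * A$2$1"
proof -
  define D where "D = (A$1$1 + A$2$2)^2 + 4 * (A$1$2 * A$2$1 - A$1$1 * A$2$2)"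
  have "D = (A$1$1 - A$2$2)^2 + 4 * (A$1$2 * A$2$1)"
    by (simp add: D_def power2_eq_square algebra_simps)
  then have "0 \<le> D" using assms by simp
  have "rho A * rho1 A = ((A$1$1 + A$2$2)^2 - (sqrt D)^2) / 4"
    unfolding rho_def rho1_def D_def[symmetric] by (simp add: power2_eq_square algebra_simps)
  also have "\<dots> = A$1$1 * A$2$2 - A$1$2 * A$2$1"
    using \<open>0 \<le> D\<close> by (simp add: D_def)
  finally show ?thesis .
qed

text \<open>The positive trace gives \<open>- rho1 A < rho A\<close>, the ordering and distinctness
  of the eigenvalues \<open>rho1 A < rho A\<close>.\<close>

lemma rho_dominant:
  assumes "\<forall>i j. 0 \<le> A$i$j" "A$1$1 + A$2$2 \<noteq> 0" "rho A \<noteq> rho1 A"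
  shows "\<bar>rho1 A\<bar> < rho A"
proof -
  have "0 \<le> A$1$1" "0 \<le> A$2$2" using assms(1) by auto
  then have "0 < rho A + rho1 A" using assms(2) rho_sum[of A] by linarith
  moreover have "rho1 A \<le> rho A"
  proof -
    have "0 \<le> (A$1$1 - A$2$2)^2 + 4 * (A$1$2 * A$2$1)" using assms(1) by simp
    also have "\<dots> = (A$1$1 + A$2$2)^2 + 4 * (A$1$2 * A$2$1 - A$1$1 * A$2$2)"
      by (simp add: power2_eq_square algebra_simps)
    finally show ?thesis by (simp add: rho_def rho1_def)
  qed
  ultimately show ?thesis using assms(3) by linarith
qed

text \<open>Given nonnegativity and \<open>b\<close>, \<open>distinct\<close> excludes exactly the
  case \<open>A$2$1 = 0\<close>, \<open>A$1$1 = A$2$2\<close>, where \<open>psi\<close> would divide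
  by zero. Definedness for \<open>n > k0\<close> covers every \<open>xi M (k + l)\<close> with
  \<open>k \<ge> k0\<close> and \<open>l \<ge> 1\<close>.\<close>

theorem theorem1:
  fixes A :: "real^2^2" and M :: "nat \<Rightarrow> real^2^2"
  assumes A_nonneg: "\<forall>i j. 0 \<le> A$i$j"
    and M_nonneg: "\<forall>k\<ge>1. \<forall>i j. 0 \<le> M k$i$j"
    and lim: "M \<longlonglongrightarrow> A"
    and trace: "A$1$1 + A$2$2 \<noteq> 0"
    and b: "A$1$2 \<noteq> 0"
    and det: "A$1$2 * A$2$1 \<noteq> A$1$1 * A$2$2"
    and distinct: "rho A \<noteq> rho1 A"
  shows "\<exists>k0>0. (\<forall>n>k0. xi_defined M n) \<and>
    (\<forall>i j. uniform_limit {k0..}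
       (\<lambda>n k. (axis i 1 \<bullet> (mat_prod M k n *v axis j 1)) / (\<Prod>l=1..n. inverse (xi M (k + l))))
       (\<lambda>k. psi A M i j k) sequentially)"
proof -

  \<comment> \<open>Choice of the threshold\<close>
  have entry_lim: "(\<lambda>n. M n$i$j) \<longlonglongrightarrow> A$i$j" for i j
    by (intro tendsto_vec_nth lim)
  have b_pos: "0 < A$1$2" using A_nonneg b by (simp add: order_less_le)
  interpret col: moebius_limit "\<lambda>n. M n$1$1" "\<lambda>n. M n$1$2" "\<lambda>n. M n$2$1" "\<lambda>n. M n$2$2"
      "A$1$1" "A$1$2" "A$2$1" "A$2$2" "rho A" "rho1 A"
    by unfold_locales
      (simp_all add: entry_lim b_pos rho_sum rho_prod[OF A_nonneg] rho_dominant[OF A_nonneg trace distinct])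
  interpret row: moebius_limit "\<lambda>n. M n$2$2" "\<lambda>n. M n$1$2" "\<lambda>n. M n$2$1" "\<lambda>n. M n$1$1"
      "A$2$2" "A$1$2" "A$2$1" "A$1$1" "rho A" "rho1 A"
    by unfold_locales
      (simp_all add: entry_lim b_pos rho_sum rho_prod[OF A_nonneg] rho_dominant[OF A_nonneg trace distinct])
  obtain N1 h where bN: "\<forall>n\<ge>N1. 0 < M n$1$2"
    and denomN: "\<forall>n\<ge>N1. \<forall>j. 0 < M n$1$1 + M n$1$2 * column_ratio M (Suc n) j"
    and column_limN: "uniform_limit {N1..} (\<lambda>j n. column_ratio M n j) h sequentially"
    and h_denomN: "\<forall>n\<ge>N1. 0 < M n$1$1 + M n$1$2 * h (Suc n)"
    and h_lim: "h \<longlonglongrightarrow> (rho A - A$1$1) / A$1$2"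
    by (rule col.iterates)
  obtain N2 where
      row_denomN: "\<forall>k\<ge>N2. \<forall>j. 0 < M (k + Suc j)$2$2 + M (k + Suc j)$1$2 * row_ratio M k j"
    and row_limN: "uniform_limit {N2..} (\<lambda>j k. row_ratio M k j) (\<lambda>_. (rho A - A$2$2) / A$1$2) sequentially"
    by (rule row.iterates)
  have "(\<lambda>n. M n$1$2 * M n$2$1 - M n$1$1 * M n$2$2) \<longlonglongrightarrow> A$1$2 * A$2$1 - A$1$1 * A$2$2"
    by (intro tendsto_intros entry_lim)
  then have "\<forall>\<^sub>F n in sequentially. M n$1$2 * M n$2$1 - M n$1$1 * M n$2$2 \<noteq> 0"
    using det by (intro tendsto_imp_eventually_ne) auto
  then obtain N3 where N3: "\<And>n. N3 \<le> n \<Longrightarrow> M n$1$2 * M n$2$1 - M n$1$1 * M n$2$2 \<noteq> 0"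
    by (auto simp: eventually_sequentially)
  \<comment> \<open>These are the numerators of \<open>cf_alpha\<close>; their limit is the trace
    times \<open>A$1$2\<close>.\<close>
  have "(\<lambda>n. M n$1$1 * M (Suc n)$1$2 + M n$1$2 * M (Suc n)$2$2) \<longlonglongrightarrow> A$1$1 * A$1$2 + A$1$2 * A$2$2"
    by (intro tendsto_intros entry_lim LIMSEQ_Suc[OF entry_lim])
  moreover have "A$1$1 * A$1$2 + A$1$2 * A$2$2 \<noteq> 0"
  proof -
    have "A$1$1 * A$1$2 + A$1$2 * A$2$2 = (A$1$1 + A$2$2) * A$1$2" by (simp add: algebra_simps)
    then show ?thesis using trace b by simp
  qed
  ultimately have "\<forall>\<^sub>F n in sequentially. M n$1$1 * M (Suc n)$1$2 + M n$1$2 * M (Suc n)$2$2 \<noteq> 0"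
    by (rule tendsto_imp_eventually_ne)
  then obtain N4 where N4: "\<And>n. N4 \<le> n \<Longrightarrow> M n$1$1 * M (Suc n)$1$2 + M n$1$2 * M (Suc n)$2$2 \<noteq> 0"
    by (auto simp: eventually_sequentially)
  define N where "N = Max {1, N1, N2, N3, N4}"
  have N: "1 \<le> N" "N1 \<le> N" "N2 \<le> N" "N3 \<le> N" "N4 \<le> N" by (auto simp: N_def)

  \<comment> \<open>Invariant directions and the value of the continued fraction\<close>
  have bn: "0 < M n$1$2" and detn: "M n$1$2 * M n$2$1 - M n$1$1 * M n$2$2 \<noteq> 0"
    and denom: "0 < M n$1$1 + M n$1$2 * column_ratio M (Suc n) j"
    and h_denom: "0 < M n$1$1 + M n$1$2 * h (Suc n)"
    and row_denom: "0 < M (n + Suc j)$2$2 + M (n + Suc j)$1$2 * row_ratio M n j"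
    if "N \<le> n" for n j
    using bN denomN h_denomN row_denomN N3 N that by auto
  have bne: "M n$1$2 \<noteq> 0" if "N \<le> n" for n
    using bn[OF that] by simp
  have denom_ne: "M n$1$1 + M n$1$2 * column_ratio M (Suc n) j \<noteq> 0" if "N \<le> n" for n j
    using denom[OF that, of j] by simp
  have column_lim: "uniform_limit {N..} (\<lambda>j n. column_ratio M n j) h sequentially"
    by (rule uniform_limit_on_subset[OF column_limN]) (use N in auto)
  have row_lim: "uniform_limit {N..} (\<lambda>j k. row_ratio M k j) (\<lambda>_. (rho A - A$2$2) / A$1$2) sequentially"
    by (rule uniform_limit_on_subset[OF row_limN]) (use N in auto)
  have column_ptlim: "(\<lambda>j. column_ratio M n j) \<longlonglongrightarrow> h n" if "N \<le> n" for n
    using tendsto_uniform_limitI[OF column_lim, of n] that by simp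
  \<comment> \<open>Letting \<open>j\<close> tend to infinity in the recursion for
    \<open>column_ratio M n (Suc j)\<close> makes the limiting directions exactly invariant.\<close>
  have h_rec: "M n$2$1 + M n$2$2 * h (Suc n) = h n * (M n$1$1 + M n$1$2 * h (Suc n))"
    if "N \<le> n" for n
  proof -
    have "(\<lambda>j. (M n$2$1 + M n$2$2 * column_ratio M (Suc n) j) /
          (M n$1$1 + M n$1$2 * column_ratio M (Suc n) j)) \<longlonglongrightarrow>
        (M n$2$1 + M n$2$2 * h (Suc n)) / (M n$1$1 + M n$1$2 * h (Suc n))"
      using h_denom[OF that] that by (intro tendsto_intros column_ptlim) auto
    then have "(\<lambda>j. column_ratio M n (Suc j)) \<longlonglongrightarrow>
        (M n$2$1 + M n$2$2 * h (Suc n)) / (M n$1$1 + M n$1$2 * h (Suc n))"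
      by (simp add: moebius_map_def)
    then have "h n = (M n$2$1 + M n$2$2 * h (Suc n)) / (M n$1$1 + M n$1$2 * h (Suc n))"
      using LIMSEQ_unique LIMSEQ_Suc[OF column_ptlim[OF that]] by blast
    then show ?thesis using h_denom[OF that] by simp
  qed
  note approx = cf_approx_column_ratio[of N M, OF bne detn denom_ne]
  have cf_lim: "(\<lambda>m. cf_approx (cf_beta M) (cf_alpha M) n m) \<longlonglongrightarrow> inverse (M n$1$1 + M n$1$2 * h (Suc n))"
    if "N \<le> n" for n
  proof (rule LIMSEQ_offset[of _ n])
    have "(\<lambda>j. inverse (M n$1$1 + M n$1$2 * column_ratio M (Suc n) j))
        \<longlonglongrightarrow> inverse (M n$1$1 + M n$1$2 * h (Suc n))"
      using h_denom[OF that] that by (intro tendsto_intros column_ptlim) auto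
    then show "(\<lambda>j. cf_approx (cf_beta M) (cf_alpha M) n (j + n)) \<longlonglongrightarrow>
        inverse (M n$1$1 + M n$1$2 * h (Suc n))"
      using approx(1)[OF _ _ _ that] by (simp add: add.commute)
  qed
  have xi_eq: "xi M n = inverse (M n$1$1 + M n$1$2 * h (Suc n))" if "N \<le> n" for n
    unfolding xi_def using cf_lim[OF that] by (rule limI)
  have xi_defined: "xi_defined M n" if "N \<le> n" for n
    unfolding xi_defined_def
  proof (intro conjI allI impI)
    fix i assume i: "n \<le> i"
    then have iN: "N \<le> i" using that by simp
    show "M i$1$2 \<noteq> 0" by (rule bne[OF iN])
    show "M (i+1)$1$2 * M (i+1)$2$1 - M (i+1)$1$1 * M (i+1)$2$2 \<noteq> 0"
      using iN by (intro detn) simp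
    then show "cf_alpha M i \<noteq> 0"
      using N4[of i] bne[OF iN] iN N by (simp add: cf_alpha_def)
    fix m assume "i < m"
    then obtain j where "m = Suc i + j" by (auto simp: less_iff_Suc_add)
    then show "cf_alpha M i + cf_approx (cf_beta M) (cf_alpha M) (Suc i) m \<noteq> 0"
      using approx(2)[OF _ _ _ iN, of j] by simp
  next
    show "convergent (\<lambda>m. cf_approx (cf_beta M) (cf_alpha M) n m)"
      using cf_lim[OF that] by (rule convergentI)
  qed

  \<comment> \<open>Normalised entries\<close>
  define Q where "Q = (\<lambda>k n. \<Prod>l=1..n. inverse (xi M (k + l)))"
  define W where "W = (\<lambda>i j n k. mat_prod M k n$i$j / Q k n)"
  define S where "S = {N..}"
  define hs zs y where "hs = (rho A - A$1$1) / A$1$2" and "zs = (rho A - A$2$2) / A$1$2"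
    and "y = A$1$2 / (rho A - rho1 A)"
  have gap: "0 < rho A - rho1 A" using col.r_diff by simp
  have Q_eq: "Q k n = (\<Prod>l=1..n. M (k + l)$1$1 + M (k + l)$1$2 * h (Suc (k + l)))" if "N \<le> k" for k n
    unfolding Q_def using that by (intro prod.cong) (auto simp: xi_eq)
  have Q_pos: "0 < Q k n" if "N \<le> k" for k n
    unfolding Q_eq[OF that] using that by (intro prod_pos h_denom) auto
  have W1: "W 1 1 n k = 1 - h (k + Suc n) * W 1 2 n k"
    and W2: "W 2 1 n k = h (Suc k) - h (k + Suc n) * W 2 2 n k" if "k \<in> S" for n k
  proof -
    have k: "N \<le> k" using that by (simp add: S_def)
    note inv = mat_prod_invariant_direction[of N M h k n, OF h_rec, folded Q_eq[OF k]]
    show "W 1 1 n k = 1 - h (k + Suc n) * W 1 2 n k"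
      "W 2 1 n k = h (Suc k) - h (k + Suc n) * W 2 2 n k"
      using inv Q_pos[OF k, of n] k by (simp_all add: W_def field_simps)
  qed
  \<comment> \<open>The row ratio and \<open>W1\<close> are two linear equations for the first row.
    The index \<open>Suc n\<close> appears because ratios describe nonempty products.\<close>
  have W12: "W 1 2 (Suc n) k = inverse (row_ratio M (Suc k) n + h (k + Suc (Suc n)))"
    and W22: "W 2 2 (Suc n) k = column_ratio M (Suc k) n * W 1 2 (Suc n) k" if "k \<in> S" for n k
  proof -
    have k: "N \<le> k" using that by (simp add: S_def)
    have "0 < mat_prod M k (Suc n)$1$2 \<and>
        mat_prod M k (Suc n)$1$1 = row_ratio M (Suc k) n * mat_prod M k (Suc n)$1$2"
      by (rule mat_prod_row_ratio[of N]) (use bn row_denom k in auto)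
    then have "W 1 1 (Suc n) k = row_ratio M (Suc k) n * W 1 2 (Suc n) k"
      by (simp add: W_def)
    with W1[OF that, of "Suc n"]
    have "(row_ratio M (Suc k) n + h (k + Suc (Suc n))) * W 1 2 (Suc n) k = 1"
      by (simp add: algebra_simps)
    then show "W 1 2 (Suc n) k = inverse (row_ratio M (Suc k) n + h (k + Suc (Suc n)))"
      by (rule inverse_unique[symmetric])
    have "mat_prod M k (Suc n)$2$2 = column_ratio M (Suc k) n * mat_prod M k (Suc n)$1$2"
      by (rule mat_prod_column_ratio[of N]) (use bne denom_ne k in auto)
    then show "W 2 2 (Suc n) k = column_ratio M (Suc k) n * W 1 2 (Suc n) k"
      by (simp add: W_def)
  qed

  \<comment> \<open>Uniform limits of the entries\<close>
  have Suc_S: "Suc \<in> S \<rightarrow> {N..}" by (auto simp: S_def)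
  have U_row: "uniform_limit S (\<lambda>n k. row_ratio M (Suc k) n) (\<lambda>_. zs) sequentially"
    using uniform_limit_compose'[OF row_lim Suc_S] by (simp add: zs_def)
  have U_col: "uniform_limit S (\<lambda>n k. column_ratio M (Suc k) n) (\<lambda>k. h (Suc k)) sequentially"
    using uniform_limit_compose'[OF column_lim Suc_S] by simp
  \<comment> \<open>Uniform in \<open>k\<close> because the index \<open>k + Suc n\<close> exceeds
    \<open>n\<close>.\<close>
  have U_h: "uniform_limit S (\<lambda>n k. h (k + Suc n)) (\<lambda>_. hs) sequentially"
  proof (rule uniform_limitI)
    fix e :: real assume "0 < e"
    then obtain K where K: "\<And>n. K \<le> n \<Longrightarrow> dist (h n) hs < e"
      using metric_LIMSEQ_D[OF h_lim] unfolding hs_def by blast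
    then show "\<forall>\<^sub>F n in sequentially. \<forall>k\<in>S. dist (h (k + Suc n)) hs < e"
      unfolding eventually_sequentially by (intro exI[of _ K]) auto
  qed
  \<comment> \<open>Uniform limits of products require bounded limit functions.\<close>
  have bounded_h: "bounded ((\<lambda>k. h (Suc k)) ` S)"
    by (rule bounded_subset[OF convergent_imp_bounded[OF h_lim]]) auto
  have bounded_const: "bounded ((\<lambda>_. c) ` S)" for c :: real
    by (simp add: image_constant_conv)
  \<comment> \<open>The limiting row and column ratios add up to
    \<open>(rho A - rho1 A) / A$1$2\<close>, which explains the constant \<open>y\<close>.\<close>
  have sum_fixed: "zs + hs = inverse y"
  proof -
    have "zs + hs = (2 * rho A - (A$1$1 + A$2$2)) / A$1$2"
      by (simp add: zs_def hs_def diff_divide_distrib add_divide_distrib)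
    also have "2 * rho A - (A$1$1 + A$2$2) = rho A - rho1 A"
      using rho_sum[of A] by simp
    finally show ?thesis by (simp add: y_def)
  qed
  have y_pos: "0 < y" using gap b_pos by (simp add: y_def)
  have U12: "uniform_limit S (W 1 2) (\<lambda>_. y) sequentially"
  proof -
    have "uniform_limit S (\<lambda>n k. h (k + Suc (Suc n))) (\<lambda>_. hs) sequentially"
      using U_h by (subst (asm) filterlim_sequentially_Suc[symmetric])
    then have "uniform_limit S (\<lambda>n k. row_ratio M (Suc k) n + h (k + Suc (Suc n))) (\<lambda>_. zs + hs) sequentially"
      by (intro uniform_limit_add U_row)
    then have "uniform_limit S (\<lambda>n k. inverse (row_ratio M (Suc k) n + h (k + Suc (Suc n))))
        (inverse \<circ> (\<lambda>_. zs + hs)) sequentially"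
      by (rule uniform_lim_inverse[where b = "inverse y"]) (use sum_fixed y_pos in auto)
    then have "uniform_limit S (\<lambda>n. W 1 2 (Suc n)) (\<lambda>_. y) sequentially"
      by (rule uniform_limit_cong[THEN iffD2, rotated 2]) (auto simp: W12 sum_fixed)
    then show ?thesis by (subst (asm) filterlim_sequentially_Suc)
  qed
  have U22: "uniform_limit S (W 2 2) (\<lambda>k. h (Suc k) * y) sequentially"
  proof -
    have "uniform_limit S (\<lambda>n. W 1 2 (Suc n)) (\<lambda>_. y) sequentially"
      using U12 by (subst filterlim_sequentially_Suc)
    then have "uniform_limit S (\<lambda>n k. column_ratio M (Suc k) n * W 1 2 (Suc n) k)
        (\<lambda>k. h (Suc k) * y) sequentially"
      by (intro uniform_lim_mult U_col bounded_h bounded_const)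
    then have "uniform_limit S (\<lambda>n. W 2 2 (Suc n)) (\<lambda>k. h (Suc k) * y) sequentially"
      by (rule uniform_limit_cong[THEN iffD2, rotated 2]) (auto simp: W22)
    then show ?thesis by (subst (asm) filterlim_sequentially_Suc)
  qed
  have U11: "uniform_limit S (W 1 1) (\<lambda>_. 1 - hs * y) sequentially"
  proof -
    have "uniform_limit S (\<lambda>n k. 1 - h (k + Suc n) * W 1 2 n k) (\<lambda>_. 1 - hs * y) sequentially"
      by (intro uniform_limit_minus uniform_limit_const uniform_lim_mult U_h U12 bounded_const)
    then show ?thesis
      by (rule uniform_limit_cong[THEN iffD2, rotated 2]) (auto simp: W1)
  qed
  have bounded_hy: "bounded ((\<lambda>k. h (Suc k) * y) ` S)"
    using bounded_scaling[OF bounded_h, of y] by (simp add: image_image mult.commute)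
  have U21: "uniform_limit S (W 2 1) (\<lambda>k. h (Suc k) - hs * (h (Suc k) * y)) sequentially"
  proof -
    have "uniform_limit S (\<lambda>n k. h (Suc k) - h (k + Suc n) * W 2 2 n k)
        (\<lambda>k. h (Suc k) - hs * (h (Suc k) * y)) sequentially"
      by (intro uniform_limit_minus uniform_limit_const uniform_lim_mult U_h U22 bounded_hy bounded_const)
    then show ?thesis
      by (rule uniform_limit_cong[THEN iffD2, rotated 2]) (auto simp: W2)
  qed

  \<comment> \<open>Identification with \<open>psi\<close>\<close>
  have x_eq: "1 - hs * y = (rho A - A$2$2) / (rho A - rho1 A)"
  proof -
    have "hs * y = (rho A - A$1$1) / (rho A - rho1 A)"
      using b by (simp add: hs_def y_def)
    then have "1 - hs * y = ((rho A - rho1 A) - (rho A - A$1$1)) / (rho A - rho1 A)"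
      using gap by (simp add: field_simps)
    also have "(rho A - rho1 A) - (rho A - A$1$1) = rho A - A$2$2"
      using rho_sum[of A] by simp
    finally show ?thesis .
  qed
  \<comment> \<open>The bracket in \<open>psi\<close> is the slope \<open>h (Suc k)\<close>: insert
    \<open>xi = 1 / x\<close> and apply \<open>h_rec\<close>.\<close>
  have h_eq: "M (k+1)$2$2 / M (k+1)$1$2 - xi M (k+1) * (det (M (k+1)) / M (k+1)$1$2) = h (Suc k)"
    if "k \<in> S" for k
  proof -
    have k: "N \<le> Suc k" using that by (simp add: S_def)
    define a' b' d' t' g x where "a' = M (Suc k)$1$1" and "b' = M (Suc k)$1$2"
      and "d' = M (Suc k)$2$1" and "t' = M (Suc k)$2$2" and "g = h (Suc (Suc k))" and "x = a' + b' * g"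
    have nz: "0 < b'" "0 < x"
      using bn[OF k] h_denom[OF k] by (auto simp: a'_def b'_def g_def x_def)
    have rec: "d' + t' * g = h (Suc k) * x"
      using h_rec[OF k] by (simp add: a'_def b'_def d'_def t'_def g_def x_def)
    have "t' / b' - inverse x * ((a' * t' - b' * d') / b') = (t' * x - (a' * t' - b' * d')) / (b' * x)"
      using nz by (simp add: field_simps)
    also have "t' * x - (a' * t' - b' * d') = b' * (d' + t' * g)"
      by (simp add: x_def algebra_simps)
    also have "b' * (d' + t' * g) / (b' * x) = h (Suc k)"
      unfolding rec using nz by simp
    finally show ?thesis
      using xi_eq[OF k] by (simp add: det_2 a'_def b'_def d'_def t'_def g_def x_def)
  qed
  have psi: "psi A M 1 1 k = 1 - hs * y" "psi A M 1 2 k = y"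
    "psi A M 2 1 k = h (Suc k) - hs * (h (Suc k) * y)" "psi A M 2 2 k = h (Suc k) * y"
    if "k \<in> S" for k
    using h_eq[OF that] by (simp_all add: psi_def y_def[symmetric] x_eq[symmetric] algebra_simps)
  have U: "uniform_limit S (W i j) (psi A M i j) sequentially" for i j
  proof -
    have "uniform_limit S (W 1 1) (psi A M 1 1) sequentially"
      by (rule uniform_limit_cong'[THEN iffD2, OF _ _ U11]) (auto simp: psi)
    moreover have "uniform_limit S (W 1 2) (psi A M 1 2) sequentially"
      by (rule uniform_limit_cong'[THEN iffD2, OF _ _ U12]) (auto simp: psi)
    moreover have "uniform_limit S (W 2 1) (psi A M 2 1) sequentially"
      by (rule uniform_limit_cong'[THEN iffD2, OF _ _ U21]) (auto simp: psi)
    moreover have "uniform_limit S (W 2 2) (psi A M 2 2) sequentially"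
      by (rule uniform_limit_cong'[THEN iffD2, OF _ _ U22]) (auto simp: psi)
    ultimately show ?thesis
      using exhaust_2[of i] exhaust_2[of j] by auto
  qed
  have "axis i 1 \<bullet> (X *v axis j 1) = X$i$j" for X :: "real^2^2" and i j
    by (simp add: inner_axis' matrix_vector_mul_component inner_axis)
  then have "\<forall>i j. uniform_limit {N..}
      (\<lambda>n k. (axis i 1 \<bullet> (mat_prod M k n *v axis j 1)) / (\<Prod>l=1..n. inverse (xi M (k + l))))
      (\<lambda>k. psi A M i j k) sequentially"
    using U by (simp add: W_def Q_def S_def)
  then show ?thesis using xi_defined N(1) by (intro exI[of _ N]) auto
qed

end
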